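(* Let $G$ be a connected graph of order $n \ge 2$. Then $\mathrm{cdim}(G)=n-1$ if and only if $G \in \{K_2, K_3\} \cup \{K_n, K_{1,n-1}\}$, where $n \ge 4$ for the members of the second set.
   Context: All graphs are finite, simple, undirected; membership is up to isomorphism. $K_n$ and $K_{1,n-1}$ are the complete graph and the star on $n$ vertices. A set $S\subseteq V(G)$ is a resolving set of $G$ if for every pair of distinct vertices $x,y$ of $G$ there is $z\in S$ with $d(x,z)\ne d(y,z)$ ($d$ is the shortest-path distance); it is a connected resolving set if moreover the induced subgraph $G[S]$ is connected. $\mathrm{cdim}(G)$ is the minimum cardinality of a connected resolving set of $G$. *)

theory Defs
  imports "Graph_Theory.Graph_Theory"
begin

text \<open>
  A finite simple undirected graph is a symmetric digraph without loops and parallel arcs (locale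
  \<open>graph\<close>), each undirected edge being a pair of opposite arcs. The complete graphs \<open>K\<^bsub>n\<^esub>\<close> and
  complete bipartite graphs \<open>K\<^bsub>m,n\<^esub>\<close> of the library are predicates that are invariant under
  isomorphism; the star on \<open>n\<close> vertices is \<open>K\<^bsub>1,n - 1\<^esub>\<close>. The name \<open>connected\<close> is
  qualified because topological connectedness has the same base name.
\<close>

text \<open>
  With all arc weights equal to 1, the cost of a walk is its length.
\<close>

definition graph_dist :: "('a,'b) pre_digraph \<Rightarrow> 'a \<Rightarrow> 'a \<Rightarrow> ereal" where
  "graph_dist G u v = wf_digraph.\<mu> G (\<lambda>_. 1) u v"

definition resolving_set :: "('a,'b) pre_digraph \<Rightarrow> 'a set \<Rightarrow> bool" where
  "resolving_set G S \<longleftrightarrow> S \<subseteq> verts G \<and>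
     (\<forall>x\<in>verts G. \<forall>y\<in>verts G. x \<noteq> y \<longrightarrow> (\<exists>z\<in>S. graph_dist G x z \<noteq> graph_dist G y z))"

definition connected_resolving_set :: "('a,'b) pre_digraph \<Rightarrow> 'a set \<Rightarrow> bool" where
  "connected_resolving_set G S \<longleftrightarrow> resolving_set G S \<and> Digraph_Component.connected (G \<restriction> S)"

definition cdim :: "('a,'b) pre_digraph \<Rightarrow> nat" where
  "cdim G = (LEAST k. \<exists>S. connected_resolving_set G S \<and> card S = k)"

lemma graph_dist_self:
  assumes "wf_digraph G" "x \<in> verts G"
  shows "graph_dist G x x \<le> 0"
proof -
  interpret wf_digraph G by fact
  have "awalk x [] x" using assms(2) by (simp add: awalk_Nil_iff)
  from min_cost_le_walk_cost[OF this, of "\<lambda>_. 1"] show ?thesis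
    by (simp add: graph_dist_def zero_ereal_def)
qed

lemma graph_dist_ge_1:
  assumes "wf_digraph G" "x \<noteq> y"
  shows "graph_dist G x y \<ge> 1"
proof -
  interpret wf_digraph G by fact
  have cost: "awalk_cost (\<lambda>_. 1) p = real (length p)" for p
    by (induct p) auto
  have "1 \<le> ereal (awalk_cost (\<lambda>_. 1) p)" if "awalk x p y" for p
  proof -
    have "p \<noteq> []" using that assms(2) by (auto simp: awalk_Nil_iff)
    then have "1 \<le> awalk_cost (\<lambda>_. 1) p" by (cases p) (simp_all add: cost)
    then show ?thesis unfolding one_ereal_def by simp
  qed
  then show ?thesis unfolding graph_dist_def \<mu>_def by (intro INF_greatest) simp
qed

text \<open>The minimum defining \<open>cdim\<close> ranges over a nonempty set.\<close>

lemma connected_resolving_set_verts: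
  assumes "graph G" "Digraph_Component.connected G"
  shows "connected_resolving_set G (verts G)"
proof -
  interpret graph G by fact
  have "G \<restriction> verts G = G"
    by (rule pre_digraph.equality) (auto simp: induce_subgraph_def)
  moreover have "\<exists>z\<in>verts G. graph_dist G x z \<noteq> graph_dist G y z"
    if "x \<in> verts G" "y \<in> verts G" "x \<noteq> y" for x y
  proof
    have *: "graph_dist G x x \<le> 0" "graph_dist G y x \<ge> 1"
      using that graph_dist_self[OF wf_digraph] graph_dist_ge_1[OF wf_digraph] by auto
    have "graph_dist G x x < graph_dist G y x"
      by (rule le_less_trans[OF *(1) less_le_trans[OF _ *(2)]]) simp
    then show "graph_dist G x x \<noteq> graph_dist G y x" by simp
  qed fact
  ultimately show ?thesis
    using assms(2) by (auto simp: connected_resolving_set_def resolving_set_def)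
qed

end

theory Submission
  imports Defs
begin

text \<open>
  Call two vertices twins if they have the same neighbours, apart from possibly each other. Twins
  have the same distance to every third vertex, so a resolving set must contain one of them.
  Conversely, if \<open>u\<close> and \<open>v\<close> are not twins, then all vertices but \<open>u\<close> and \<open>v\<close> form a resolving set:
  some remaining vertex is adjacent to exactly one of the two, and every other pair contains a
  vertex of the set, which tells itself apart from anything else.

  In a complete graph any two vertices are twins, so a resolving set misses at most one vertex. In a
  star any two leaves are twins, so a resolving set misses at most one leaf; with at least four
  vertices it contains two leaves, and connectedness then forces the centre into it. As deleting a
  single non-cut vertex always leaves a connected resolving set, the connected dimension is
  \<open>n - 1\<close> for these graphs.

  For the other direction, \<open>cdim G = n - 1\<close> implies that \<open>u\<close> and \<open>v\<close> are twins whenever deleting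
  both leaves a connected graph. Take a non-cut vertex \<open>u\<close>. Every non-cut vertex of \<open>G - u\<close> is then
  a twin of \<open>u\<close>; let \<open>v\<close> be one. The neighbours and the twins of \<open>u\<close> together induce a connected
  subgraph of \<open>G - u\<close>. If this were a proper subgraph, growing it vertex by vertex to \<open>G - u\<close> would
  end in a non-cut vertex of \<open>G - u\<close> that is not a twin of \<open>u\<close>. Hence every other vertex is a
  neighbour or a twin of \<open>u\<close> (lemma \<open>neighbours_twins_cover\<close>). There are two cases.

  If \<open>u\<close> and \<open>v\<close> are adjacent, both dominate \<open>G\<close>. For any \<open>x\<close> different from both, \<open>G - {u, x}\<close> is
  connected through \<open>v\<close>, so \<open>x\<close> is a twin of the dominating vertex \<open>u\<close> and is itself dominating:
  \<open>G\<close> is complete.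

  If they are not adjacent, the vertices outside the neighbourhood \<open>N\<close> of \<open>u\<close> form an independent
  set \<open>I\<close> that is completely joined to \<open>N\<close>. If \<open>N\<close> contained two vertices \<open>x\<close> and \<open>q\<close>, then
  \<open>G - {u, x}\<close> would be connected through \<open>v\<close> and \<open>q\<close>, although \<open>v\<close> is adjacent to \<open>x\<close> and not to
  \<open>u\<close>. So \<open>N\<close> is a single vertex and \<open>G\<close> is a star.

  This argument needs three vertices. A connected graph on two vertices is \<open>K\<^bsub>2\<^esub>\<close>, and the star on
  three vertices is excluded because its centre and a leaf are not twins, while deleting them leaves
  a single vertex.
\<close>

section \<open>Connected induced subgraphs\<close>

lemma (in sym_digraph) dominates_sym: "x \<rightarrow>\<^bsub>G\<^esub> y \<Longrightarrow> y \<rightarrow>\<^bsub>G\<^esub> x"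
  using arcs_ends_symmetric[OF sym_arcs] .

lemma dominates_induce_iff: "x \<rightarrow>\<^bsub>G \<restriction> A\<^esub> y \<longleftrightarrow> x \<rightarrow>\<^bsub>G\<^esub> y \<and> x \<in> A \<and> y \<in> A"
  by (auto simp: arcs_ends_conv)

lemma (in sym_digraph) symmetric_induce: "symmetric (G \<restriction> A)"
  unfolding symmetric_def sym_def by (auto simp: dominates_induce_iff dominates_sym)

lemma (in sym_digraph) connected_induce_reachable:
  assumes "Digraph_Component.connected (G \<restriction> A)" "x \<in> A" "y \<in> A"
  shows "x \<rightarrow>\<^sup>*\<^bsub>G \<restriction> A\<^esub> y"
  using wf_digraph.symmetric_connected_imp_strongly_connected[OF wellformed_induce_subgraph symmetric_induce assms(1)]
    assms(2,3) by (auto simp: strongly_connected_def)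

lemma (in sym_digraph) connected_induceI:
  assumes r: "r \<in> A" and reach: "\<And>x. x \<in> A \<Longrightarrow> x \<rightarrow>\<^sup>*\<^bsub>G \<restriction> A\<^esub> r"
  shows "Digraph_Component.connected (G \<restriction> A)"
proof -
  interpret GA: wf_digraph "G \<restriction> A" by (rule wellformed_induce_subgraph)
  have "x \<rightarrow>\<^sup>*\<^bsub>G \<restriction> A\<^esub> y" if "x \<in> A" "y \<in> A" for x y
    using GA.reachable_trans[OF reach[OF that(1)] symmetric_reachable[OF symmetric_induce reach[OF that(2)]]] .
  then show ?thesis using r by (intro GA.connectedI GA.reachable_mk_symmetricI) auto
qed

lemma (in sym_digraph) connected_induce_hub:
  assumes r: "r \<in> A"
    and near: "\<And>x. x \<in> A \<Longrightarrow> x = r \<or> x \<rightarrow>\<^bsub>G\<^esub> r \<or> (\<exists>w\<in>A. x \<rightarrow>\<^bsub>G\<^esub> w \<and> w \<rightarrow>\<^bsub>G\<^esub> r)"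
  shows "Digraph_Component.connected (G \<restriction> A)"
proof (rule connected_induceI[OF r])
  interpret GA: wf_digraph "G \<restriction> A" by (rule wellformed_induce_subgraph)
  fix x assume x: "x \<in> A"
  have step: "a \<rightarrow>\<^sup>*\<^bsub>G \<restriction> A\<^esub> b" if "a \<rightarrow>\<^bsub>G\<^esub> b" "a \<in> A" "b \<in> A" for a b
    using that by (intro GA.reachable_adjI) (simp add: dominates_induce_iff)
  from near[OF x] show "x \<rightarrow>\<^sup>*\<^bsub>G \<restriction> A\<^esub> r"
    using step x r GA.reachable_refl GA.reachable_trans by (metis induce_subgraph_verts)
qed

lemma (in sym_digraph) connected_induce_insert:
  assumes A: "Digraph_Component.connected (G \<restriction> A)" and x: "x \<in> A" and wx: "w \<rightarrow>\<^bsub>G\<^esub> x"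
  shows "Digraph_Component.connected (G \<restriction> insert w A)"
proof (rule connected_induceI)
  interpret GA: wf_digraph "G \<restriction> insert w A" by (rule wellformed_induce_subgraph)
  show "x \<in> insert w A" using x by simp
  fix y assume "y \<in> insert w A"
  then consider "y = w" | "y \<in> A" by auto
  then show "y \<rightarrow>\<^sup>*\<^bsub>G \<restriction> insert w A\<^esub> x"
  proof cases
    case 1
    then show ?thesis using wx x by (intro GA.reachable_adjI) (simp add: dominates_induce_iff)
  next
    case 2
    then show ?thesis
      using reachable_induce_ss[OF connected_induce_reachable[OF A 2 x]] by blast
  qed
qed

lemma (in sym_digraph) connected_induce_cut_arc:
  assumes B: "Digraph_Component.connected (G \<restriction> B)" and "A \<subseteq> B" "a \<in> A" "b \<in> B - A"
  obtains w x where "w \<in> B - A" "x \<in> A" "w \<rightarrow>\<^bsub>G\<^esub> x"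
proof -
  interpret GB: wf_digraph "G \<restriction> B" by (rule wellformed_induce_subgraph)
  have "b \<rightarrow>\<^sup>*\<^bsub>G \<restriction> B\<^esub> a" using assms by (intro connected_induce_reachable) auto
  then have "b \<in> B - A \<longrightarrow> (\<exists>w\<in>B - A. \<exists>x\<in>A. w \<rightarrow>\<^bsub>G\<^esub> x)"
  proof (induction rule: GB.converse_reachable_induct)
    case base
    then show ?case using assms(3) by simp
  next
    case (step x y)
    then show ?case by (auto simp: dominates_induce_iff)
  qed
  with assms(4) that show thesis by blast
qed

text \<open>
  A connected proper part can be grown one vertex at a time while staying connected; the vertex
  added last is not a cut vertex of the whole.
\<close>

lemma (in sym_digraph) exists_noncut_outside:
  assumes "finite B" "Digraph_Component.connected (G \<restriction> B)"
    and "Digraph_Component.connected (G \<restriction> A)" "A \<subset> B" "A \<noteq> {}"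
  shows "\<exists>w\<in>B - A. Digraph_Component.connected (G \<restriction> (B - {w}))"
  using assms(3-5)
proof (induction "card (B - A)" arbitrary: A rule: less_induct)
  case less
  obtain w x where w: "w \<in> B - A" and x: "x \<in> A" and wx: "w \<rightarrow>\<^bsub>G\<^esub> x"
    using less.prems connected_induce_cut_arc[OF assms(2), of A] by blast
  have conn: "Digraph_Component.connected (G \<restriction> insert w A)"
    by (rule connected_induce_insert[OF less.prems(1) x wx])
  show ?case
  proof (cases "insert w A = B")
    case True
    then have "B - {w} = A" using w by auto
    then show ?thesis using less.prems(1) w by auto
  next
    case False
    have "card (B - insert w A) < card (B - A)"
      using w assms(1) by (intro psubset_card_mono) auto
    then show ?thesis using less.hyps[OF _ conn] False w less.prems(2) by auto
  qed
qed

section \<open>Twins and distances\<close>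

text \<open>
  Adjacent and non-adjacent twins are treated alike, because both are indistinguishable to all
  other vertices.
\<close>

definition twins :: "('a,'b) pre_digraph \<Rightarrow> 'a \<Rightarrow> 'a \<Rightarrow> bool" where
  "twins G u v \<longleftrightarrow> (\<forall>z. z \<noteq> u \<longrightarrow> z \<noteq> v \<longrightarrow> (z \<rightarrow>\<^bsub>G\<^esub> u \<longleftrightarrow> z \<rightarrow>\<^bsub>G\<^esub> v))"

lemma twins_sym: "twins G u v \<Longrightarrow> twins G v u"
  by (auto simp: twins_def)

lemma (in wf_digraph) awalk_cost_one: "awalk_cost (\<lambda>_. 1) p = real (length p)"
  by (induction p) auto

lemma (in wf_digraph) graph_dist_le_length:
  "awalk u p v \<Longrightarrow> graph_dist G u v \<le> ereal (real (length p))"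
  using min_cost_le_walk_cost[of u p v "\<lambda>_. 1"] by (simp add: graph_dist_def awalk_cost_one)

lemma (in wf_digraph) graph_dist_greatest:
  assumes "\<And>p. awalk u p v \<Longrightarrow> d \<le> ereal (real (length p))"
  shows "d \<le> graph_dist G u v"
  unfolding graph_dist_def \<mu>_def by (intro INF_greatest) (simp add: assms awalk_cost_one)

text \<open>
  Since adjacency can be read off from the distance, a vertex adjacent to exactly one of two others
  resolves them.
\<close>

lemma (in wf_digraph) graph_dist_le_1_iff:
  assumes "u \<noteq> v"
  shows "graph_dist G u v \<le> 1 \<longleftrightarrow> u \<rightarrow>\<^bsub>G\<^esub> v"
proof
  assume "u \<rightarrow>\<^bsub>G\<^esub> v"
  then obtain e where "e \<in> arcs G" "tail G e = u" "head G e = v" by blast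
  then have "awalk u [e] v" using arc_implies_awalk by blast
  from graph_dist_le_length[OF this] show "graph_dist G u v \<le> 1" by (simp add: one_ereal_def)
next
  assume le: "graph_dist G u v \<le> 1"
  show "u \<rightarrow>\<^bsub>G\<^esub> v"
  proof (rule ccontr)
    assume na: "\<not> u \<rightarrow>\<^bsub>G\<^esub> v"
    have "2 \<le> length p" if "awalk u p v" for p
      using that assms na
      by (cases p; cases "tl p") (auto simp: awalk_simps arcs_ends_conv)
    then have "ereal 2 \<le> graph_dist G u v" by (intro graph_dist_greatest) force
    with le have "ereal 2 \<le> 1" by (rule order_trans[rotated])
    then show False by (simp add: one_ereal_def)
  qed
qed

text \<open>
  Exchanging the first vertex of a walk by its twin gives a walk of the same length, unless the
  second vertex is that twin; then dropping the first arc gives a shorter one.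
\<close>

lemma (in graph) twins_dist_le:
  assumes "twins G u v" "z \<noteq> u" "z \<noteq> v"
  shows "graph_dist G v z \<le> graph_dist G u z"
proof (rule graph_dist_greatest)
  fix p assume p: "awalk u p z"
  then obtain e q where pq: "p = e # q" using assms(2) by (cases p) (auto simp: awalk_Nil_iff)
  have e: "e \<in> arcs G" "tail G e = u" and q: "awalk (head G e) q z"
    using p unfolding pq by (auto simp: awalk_Cons_iff)
  consider "head G e = v" | "head G e = u" | "head G e \<noteq> u" "head G e \<noteq> v" by auto
  then have "\<exists>p'. awalk v p' z \<and> length p' \<le> length p"
  proof cases
    case 1
    then show ?thesis using q pq by auto
  next
    case 2
    then show ?thesis using e no_loops by blast
  next
    case 3
    then have "head G e \<rightarrow>\<^bsub>G\<^esub> v" using assms(1) e dominates_sym unfolding twins_def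
      by (metis in_arcs_imp_in_arcs_ends)
    then obtain f where "f \<in> arcs G" "tail G f = v" "head G f = head G e"
      using dominates_sym by blast
    then have "awalk v (f # q) z" using q by (simp add: awalk_Cons_iff)
    then show ?thesis unfolding pq by (intro exI[of _ "f # q"]) simp
  qed
  then obtain p' where "awalk v p' z" "length p' \<le> length p" by blast
  then show "graph_dist G v z \<le> ereal (real (length p))"
    using graph_dist_le_length[of v p' z] by (meson ereal_less_eq(3) of_nat_le_iff order_trans)
qed

lemma (in graph) twins_dist_eq:
  assumes "twins G u v" "z \<noteq> u" "z \<noteq> v"
  shows "graph_dist G u z = graph_dist G v z"
  using twins_dist_le[OF assms] twins_dist_le[OF twins_sym[OF assms(1)] assms(3,2)]
  by (rule antisym[rotated])

section \<open>Resolving sets\<close>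

lemma (in graph) resolving_set_meets_twins:
  assumes "resolving_set G S" "twins G u v" "u \<in> verts G" "v \<in> verts G" "u \<noteq> v"
  shows "u \<in> S \<or> v \<in> S"
proof (rule ccontr)
  assume not: "\<not> (u \<in> S \<or> v \<in> S)"
  obtain z where "z \<in> S" "graph_dist G u z \<noteq> graph_dist G v z"
    using assms unfolding resolving_set_def by blast
  with not show False using twins_dist_eq[OF assms(2), of z] by blast
qed

lemma (in graph) graph_dist_self_neq:
  assumes "x \<in> verts G" "x \<noteq> y"
  shows "graph_dist G x x \<noteq> graph_dist G y x"
proof -
  have dist: "graph_dist G x x \<le> 0" "1 \<le> graph_dist G y x"
    using assms graph_dist_self[OF wf_digraph] graph_dist_ge_1[OF wf_digraph] by auto
  have "graph_dist G x x < graph_dist G y x"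
    by (rule le_less_trans[OF dist(1) less_le_trans[OF _ dist(2)]]) simp
  then show ?thesis by simp
qed

text \<open>
  A vertex of the set resolves every pair that it belongs to.
\<close>

lemma (in graph) resolving_set_if_separates_rest:
  assumes "S \<subseteq> verts G"
    and "\<And>x y. x \<in> verts G - S \<Longrightarrow> y \<in> verts G - S \<Longrightarrow> x \<noteq> y \<Longrightarrow>
      \<exists>z\<in>S. graph_dist G x z \<noteq> graph_dist G y z"
  shows "resolving_set G S"
  unfolding resolving_set_def
proof (intro conjI ballI impI)
  show "S \<subseteq> verts G" by fact
  fix x y assume xy: "x \<in> verts G" "y \<in> verts G" "x \<noteq> y"
  consider "x \<in> S" | "y \<in> S" | "x \<notin> S" "y \<notin> S" by blast
  then show "\<exists>z\<in>S. graph_dist G x z \<noteq> graph_dist G y z"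
  proof cases
    case 1
    then show ?thesis using graph_dist_self_neq[OF xy(1,3)] by blast
  next
    case 2
    then show ?thesis using graph_dist_self_neq[of y x] xy by metis
  next
    case 3
    then show ?thesis using assms(2) xy by blast
  qed
qed

lemma (in graph) not_twins_resolving:
  assumes "\<not> twins G u v" "u \<in> verts G" "v \<in> verts G"
  shows "resolving_set G (verts G - {u, v})"
proof (rule resolving_set_if_separates_rest)
  obtain z where z: "z \<noteq> u" "z \<noteq> v" "(z \<rightarrow>\<^bsub>G\<^esub> u) \<noteq> (z \<rightarrow>\<^bsub>G\<^esub> v)"
    using assms(1) unfolding twins_def by blast
  then have zV: "z \<in> verts G" using adj_in_verts by blast
  have "(u \<rightarrow>\<^bsub>G\<^esub> z) \<noteq> (v \<rightarrow>\<^bsub>G\<^esub> z)" using z(3) dominates_sym by blast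
  then have "graph_dist G u z \<noteq> graph_dist G v z"
    using graph_dist_le_1_iff[of u z] graph_dist_le_1_iff[of v z] z(1,2) by metis
  then show "\<exists>z\<in>verts G - {u, v}. graph_dist G x z \<noteq> graph_dist G y z"
    if "x \<in> verts G - (verts G - {u, v})" "y \<in> verts G - (verts G - {u, v})" "x \<noteq> y" for x y
    using that z zV by (intro bexI[of _ z]) auto
qed blast

section \<open>Bounds on the connected dimension\<close>

lemma cdim_le:
  "connected_resolving_set G S \<Longrightarrow> cdim G \<le> card S"
  unfolding cdim_def by (rule Least_le) blast

lemma cdim_attained:
  assumes "graph G" "Digraph_Component.connected G"
  obtains S where "connected_resolving_set G S" "card S = cdim G"
proof -
  have "\<exists>S. connected_resolving_set G S \<and> card S = cdim G"
    unfolding cdim_def by (rule LeastI_ex) (use connected_resolving_set_verts[OF assms] in blast)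
  then show thesis using that by blast
qed

lemma (in wf_digraph) induce_verts: "G \<restriction> verts G = G"
  by (rule pre_digraph.equality) (auto simp: induce_subgraph_def)

lemma (in graph) exists_noncut:
  assumes "A \<subseteq> verts G" "Digraph_Component.connected (G \<restriction> A)" "card A \<ge> 2"
  shows "\<exists>w\<in>A. Digraph_Component.connected (G \<restriction> (A - {w}))"
proof -
  have fin: "finite A" using assms(1) finite_verts finite_subset by blast
  obtain a where a: "a \<in> A" using assms(3) by (cases "A = {}") auto
  moreover have "{a} \<noteq> A" using assms(3) by auto
  moreover have "Digraph_Component.connected (G \<restriction> {a})"
    by (rule connected_induce_hub[of a]) auto
  ultimately show ?thesis using exists_noncut_outside[OF fin assms(2), of "{a}"] by blast
qed

lemma (in graph) cdim_le_card_minus_1: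
  assumes "Digraph_Component.connected G" "card (verts G) \<ge> 2"
  shows "cdim G \<le> card (verts G) - 1"
proof -
  obtain w where w: "w \<in> verts G" "Digraph_Component.connected (G \<restriction> (verts G - {w}))"
    using exists_noncut[of "verts G"] assms induce_verts by auto
  have "resolving_set G (verts G - {w})"
    by (rule resolving_set_if_separates_rest) auto
  then have "cdim G \<le> card (verts G - {w})"
    using w by (intro cdim_le) (simp add: connected_resolving_set_def)
  then show ?thesis using w by simp
qed

section \<open>Complete graphs and stars\<close>

lemma (in graph) complete_digraph_iff:
  "K\<^bsub>card (verts G)\<^esub> G \<longleftrightarrow> (\<forall>x\<in>verts G. \<forall>y\<in>verts G. x \<noteq> y \<longrightarrow> x \<rightarrow>\<^bsub>G\<^esub> y)"
proof -
  have "graph G" by unfold_locales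
  moreover have "arcs_ends G \<subseteq> {(x, y). (x, y) \<in> verts G \<times> verts G \<and> x \<noteq> y}"
    using adj_in_verts adj_not_same by blast
  ultimately show ?thesis unfolding complete_digraph_def by blast
qed

lemma (in graph) star_digraph_iff:
  assumes "card (verts G) \<ge> 2"
  shows "K\<^bsub>1,card (verts G) - 1\<^esub> G \<longleftrightarrow> (\<exists>p\<in>verts G. \<forall>x y. x \<rightarrow>\<^bsub>G\<^esub> y \<longleftrightarrow>
    x \<in> verts G \<and> y \<in> verts G \<and> (x = p) \<noteq> (y = p))"
proof
  assume "K\<^bsub>1,card (verts G) - 1\<^esub> G"
  then obtain U V where UV: "verts G = U \<union> V" "U \<inter> V = {}" "card U = 1"
    "arcs_ends G = U \<times> V \<union> V \<times> U"
    unfolding complete_bipartite_digraph_def by blast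
  from UV(3) obtain p where U: "U = {p}" by (auto simp: card_1_singleton_iff)
  have "x \<rightarrow>\<^bsub>G\<^esub> y \<longleftrightarrow> x \<in> verts G \<and> y \<in> verts G \<and> (x = p) \<noteq> (y = p)" for x y
    using UV(2) unfolding UV(1,4) U by blast
  then show "\<exists>p\<in>verts G. \<forall>x y. x \<rightarrow>\<^bsub>G\<^esub> y \<longleftrightarrow>
    x \<in> verts G \<and> y \<in> verts G \<and> (x = p) \<noteq> (y = p)"
    using UV(1) U by blast
next
  assume "\<exists>p\<in>verts G. \<forall>x y. x \<rightarrow>\<^bsub>G\<^esub> y \<longleftrightarrow>
    x \<in> verts G \<and> y \<in> verts G \<and> (x = p) \<noteq> (y = p)"
  then obtain p where p: "p \<in> verts G"
    and adj: "\<And>x y. x \<rightarrow>\<^bsub>G\<^esub> y \<longleftrightarrow> x \<in> verts G \<and> y \<in> verts G \<and> (x = p) \<noteq> (y = p)"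
    by blast
  have "graph G" by unfold_locales
  moreover have "z \<in> arcs_ends G \<longleftrightarrow> z \<in> {p} \<times> (verts G - {p}) \<union> (verts G - {p}) \<times> {p}" for z
    using adj[of "fst z" "snd z"] p by (cases z) auto
  then have "arcs_ends G = {p} \<times> (verts G - {p}) \<union> (verts G - {p}) \<times> {p}" by blast
  moreover have "verts G = {p} \<union> (verts G - {p})" "{p} \<inter> (verts G - {p}) = {}"
    "card {p} = 1" "card (verts G - {p}) = card (verts G) - 1"
    using p by auto
  ultimately show "K\<^bsub>1,card (verts G) - 1\<^esub> G"
    unfolding complete_bipartite_digraph_def by blast
qed

lemma (in graph) complete_resolving_set_card_ge:
  assumes "K\<^bsub>card (verts G)\<^esub> G" "resolving_set G S"
  shows "card (verts G) - 1 \<le> card S"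
proof -
  have S: "S \<subseteq> verts G" using assms(2) by (simp add: resolving_set_def)
  have "x = y" if "x \<in> verts G - S" "y \<in> verts G - S" for x y
  proof (rule ccontr)
    assume "x \<noteq> y"
    moreover have "twins G x y"
      unfolding twins_def using that assms(1) adj_in_verts unfolding complete_digraph_iff
      by (metis DiffD1)
    ultimately show False using resolving_set_meets_twins[OF assms(2)] that by blast
  qed
  then have "card (verts G - S) \<le> 1" by (simp add: card_le_Suc0_iff_eq)
  then show ?thesis using S by (simp add: card_Diff_subset finite_subset[OF S])
qed

lemma (in graph) star_connected_resolving_set_card_ge:
  assumes "K\<^bsub>1,card (verts G) - 1\<^esub> G" "connected_resolving_set G S" "card (verts G) \<ge> 4"
  shows "card (verts G) - 1 \<le> card S"
proof -
  have res: "resolving_set G S" and conn: "Digraph_Component.connected (G \<restriction> S)"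
    using assms(2) by (auto simp: connected_resolving_set_def)
  have S: "S \<subseteq> verts G" using res by (simp add: resolving_set_def)
  obtain p where p: "p \<in> verts G"
    and adj: "\<And>x y. x \<rightarrow>\<^bsub>G\<^esub> y \<longleftrightarrow> x \<in> verts G \<and> y \<in> verts G \<and> (x = p) \<noteq> (y = p)"
    using assms(1,3) star_digraph_iff by auto
  have leaves: "x = y" if "x \<in> verts G - S - {p}" "y \<in> verts G - S - {p}" for x y
  proof (rule ccontr)
    assume "x \<noteq> y"
    moreover have "twins G x y"
      unfolding twins_def using that adj by auto
    ultimately show False using resolving_set_meets_twins[OF res] that by blast
  qed
  then have le1: "card (verts G - S - {p}) \<le> 1" by (simp add: card_le_Suc0_iff_eq)
  \<comment> \<open>Without the centre, the set would be independent, yet it has at least two vertices.\<close>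
  have "p \<in> S"
  proof (rule ccontr)
    assume pS: "p \<notin> S"
    have fin: "finite S" using S finite_verts by (rule finite_subset)
    have "card (verts G - S) = card (verts G) - card S"
      using fin S by (rule card_Diff_subset)
    moreover have "card (verts G - S - {p}) = card (verts G - S) - 1"
      using pS p by (intro card_Diff_singleton) simp
    ultimately have "card S \<ge> 2" using le1 assms(3) by linarith
    then have "\<not> card S \<le> Suc 0" by simp
    then obtain a b where ab: "a \<in> S" "b \<in> S" "a \<noteq> b"
      using card_le_Suc0_iff_eq[OF fin] by blast
    then obtain w x where "w \<in> S - {a}" "x \<in> {a}" "w \<rightarrow>\<^bsub>G\<^esub> x"
      using connected_induce_cut_arc[OF conn, of "{a}" a b] by auto
    then show False using adj pS ab(1) by auto
  qed
  then have "verts G - S - {p} = verts G - S" by auto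
  then show ?thesis using le1 S by (simp add: card_Diff_subset finite_subset[OF S])
qed

section \<open>Graphs whose jointly removable pairs are twins\<close>

text \<open>
  This is what remains of the hypothesis on the connected dimension: a pair that is not a pair of
  twins and whose removal keeps the graph connected would leave a connected resolving set on
  \<open>n - 2\<close> vertices.
\<close>

definition connected_rest_twins :: "('a,'b) pre_digraph \<Rightarrow> bool" where
  "connected_rest_twins G \<longleftrightarrow> (\<forall>u\<in>verts G. \<forall>v\<in>verts G. u \<noteq> v \<longrightarrow>
     Digraph_Component.connected (G \<restriction> (verts G - {u, v})) \<longrightarrow> twins G u v)"

lemma connected_rest_twinsD:
  assumes "connected_rest_twins G" "Digraph_Component.connected (G \<restriction> (verts G - {u, v}))"
    and "u \<in> verts G" "v \<in> verts G" "u \<noteq> v"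
  shows "twins G u v"
  using assms unfolding connected_rest_twins_def by simp

text \<open>
  With \<open>u\<close> a non-cut vertex and \<open>H = G - u\<close>, all non-cut vertices of \<open>H\<close> are twins of \<open>u\<close>. The
  neighbours and twins of \<open>u\<close> span a connected part \<open>A\<close> of \<open>H\<close>: any twin \<open>v\<close> of \<open>u\<close> is joined to
  each of them directly or through a neighbour \<open>q\<close> of \<open>u\<close>. A vertex of \<open>H\<close> outside \<open>A\<close> would
  yield a non-cut vertex outside \<open>A\<close>, hence not a twin of \<open>u\<close>.
\<close>

lemma (in graph) neighbours_twins_cover:
  assumes conn: "Digraph_Component.connected G" and card3: "card (verts G) \<ge> 3"
    and tw: "connected_rest_twins G"
  obtains u v where "u \<in> verts G" "v \<in> verts G" "u \<noteq> v" "twins G u v"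
    "\<And>x. x \<in> verts G \<Longrightarrow> x = u \<or> x \<rightarrow>\<^bsub>G\<^esub> u \<or> twins G u x"
proof -
  have sym: "x \<rightarrow>\<^bsub>G\<^esub> y \<longleftrightarrow> y \<rightarrow>\<^bsub>G\<^esub> x" for x y using dominates_sym by blast
  obtain u where u: "u \<in> verts G" and Hconn: "Digraph_Component.connected (G \<restriction> (verts G - {u}))"
    using exists_noncut[of "verts G"] conn card3 induce_verts by auto
  define H where "H = verts G - {u}"
  have finH: "finite H" by (simp add: H_def)
  have cardH: "card H \<ge> 2" using u card3 by (simp add: H_def)
  have noncut_twin: "twins G u w"
    if "w \<in> H" "Digraph_Component.connected (G \<restriction> (H - {w}))" for w
  proof -
    have "verts G - {u, w} = H - {w}" by (auto simp: H_def)
    then show ?thesis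
      using connected_rest_twinsD[OF tw, of u w] u that by (auto simp: H_def)
  qed
  obtain v where v: "v \<in> H" and "Digraph_Component.connected (G \<restriction> (H - {v}))"
    using exists_noncut[of H] Hconn cardH by (auto simp: H_def)
  then have uv: "twins G u v" by (auto intro: noncut_twin)
  have vV: "v \<in> verts G" and vu: "v \<noteq> u" using v by (auto simp: H_def)
  obtain q where q: "q \<in> H" "q \<rightarrow>\<^bsub>G\<^esub> u"
    using connected_induce_cut_arc[of "verts G" "{u}" u v] conn induce_verts u vV vu
    by (auto simp: H_def)
  define A where "A = {x \<in> H. x \<rightarrow>\<^bsub>G\<^esub> u \<or> twins G u x}"
  have Aconn: "Digraph_Component.connected (G \<restriction> A)"
  proof (rule connected_induce_hub[of v])
    show "v \<in> A" using v uv by (simp add: A_def)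
    fix x assume x: "x \<in> A"
    then have xu: "x \<noteq> u" by (auto simp: A_def H_def)
    consider "x = v" | "x \<noteq> v" "x \<rightarrow>\<^bsub>G\<^esub> u" | "x \<noteq> v" "twins G u x" "v \<rightarrow>\<^bsub>G\<^esub> u"
      | "\<not> x \<rightarrow>\<^bsub>G\<^esub> u" "twins G u x" "\<not> v \<rightarrow>\<^bsub>G\<^esub> u"
      using x by (auto simp: A_def)
    then show "x = v \<or> x \<rightarrow>\<^bsub>G\<^esub> v \<or> (\<exists>w\<in>A. x \<rightarrow>\<^bsub>G\<^esub> w \<and> w \<rightarrow>\<^bsub>G\<^esub> v)"
    proof cases
      case 2
      then show ?thesis using uv xu unfolding twins_def by blast
    next
      case 3
      then have "v \<rightarrow>\<^bsub>G\<^esub> x" using vu unfolding twins_def by metis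
      then show ?thesis using sym by blast
    next
      case 4
      have "q \<noteq> u" using q(1) by (simp add: H_def)
      moreover have "q \<noteq> v" "q \<noteq> x" using q(2) 4 by auto
      ultimately have "q \<rightarrow>\<^bsub>G\<^esub> v" "q \<rightarrow>\<^bsub>G\<^esub> x" using uv 4(2) q(2) unfolding twins_def by blast+
      moreover have "q \<in> A" using q by (simp add: A_def)
      ultimately show ?thesis using sym by blast
    qed simp
  qed
  have "A = H"
  proof (rule ccontr)
    assume "A \<noteq> H"
    then have "A \<subset> H" by (auto simp: A_def)
    moreover have "A \<noteq> {}" using v uv by (auto simp: A_def)
    ultimately obtain w where "w \<in> H - A" "Digraph_Component.connected (G \<restriction> (H - {w}))"
      using exists_noncut_outside[OF finH _ Aconn] Hconn by (auto simp: H_def)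
    then show False using noncut_twin[of w] by (auto simp: A_def)
  qed
  then have "x = u \<or> x \<rightarrow>\<^bsub>G\<^esub> u \<or> twins G u x" if "x \<in> verts G" for x
    using that unfolding A_def H_def by blast
  then show thesis using that u vV vu uv by blast
qed

text \<open>
  Adjacency of \<open>u\<close> and \<open>v\<close> passes to all twins of \<open>u\<close>, so \<open>u\<close> dominates the graph, and so does
  its twin \<open>v\<close>. With \<open>v\<close> holding the rest together, \<open>u\<close> can be removed along with any
  third vertex \<open>x\<close>; thus \<open>x\<close> is a twin of \<open>u\<close> and dominates as well.
\<close>

lemma (in graph) adjacent_twins_imp_complete:
  assumes tw: "connected_rest_twins G"
    and V: "u \<in> verts G" "v \<in> verts G" and uv: "u \<noteq> v" "twins G u v" and adj: "v \<rightarrow>\<^bsub>G\<^esub> u"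
    and cover: "\<And>x. x \<in> verts G \<Longrightarrow> x = u \<or> x \<rightarrow>\<^bsub>G\<^esub> u \<or> twins G u x"
  shows "K\<^bsub>card (verts G)\<^esub> G"
proof -
  have sym: "x \<rightarrow>\<^bsub>G\<^esub> y \<longleftrightarrow> y \<rightarrow>\<^bsub>G\<^esub> x" for x y using dominates_sym by blast
  have hub_u: "x \<rightarrow>\<^bsub>G\<^esub> u" if x: "x \<in> verts G" "x \<noteq> u" for x
  proof (cases "x = v \<or> x \<rightarrow>\<^bsub>G\<^esub> u")
    case True
    then show ?thesis using adj by blast
  next
    case False
    then have "twins G u x" using cover[OF x(1)] x(2) by blast
    then have "v \<rightarrow>\<^bsub>G\<^esub> x" using adj False uv(1) unfolding twins_def by metis
    then show ?thesis using uv(2) x(2) False sym unfolding twins_def by metis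
  qed
  then have hub_v: "x \<rightarrow>\<^bsub>G\<^esub> v" if "x \<in> verts G" "x \<noteq> v" for x
    using that uv(2) adj sym unfolding twins_def by metis
  have "x \<rightarrow>\<^bsub>G\<^esub> y" if xy: "x \<in> verts G" "y \<in> verts G" "x \<noteq> y" for x y
  proof (cases "x = u \<or> x = v \<or> y = u")
    case True
    then show ?thesis using hub_u hub_v xy sym by metis
  next
    case False
    then have "Digraph_Component.connected (G \<restriction> (verts G - {u, x}))"
      using hub_v V uv(1) by (intro connected_induce_hub[of v]) auto
    then have "twins G u x"
      by (rule connected_rest_twinsD[OF tw]) (use V(1) xy(1) False in auto)
    moreover have "y \<rightarrow>\<^bsub>G\<^esub> u" using hub_u xy(2) False by blast
    ultimately have "y \<rightarrow>\<^bsub>G\<^esub> x" using xy(3) False unfolding twins_def by metis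
    then show ?thesis using sym by blast
  qed
  then show ?thesis unfolding complete_digraph_iff by blast
qed

text \<open>
  The graph is the join of the neighbourhood \<open>N\<close> of \<open>u\<close> with the independent set \<open>I\<close> of the
  other vertices. A second vertex in \<open>N\<close> would make \<open>u \<in> I\<close> removable together with a vertex of
  \<open>N\<close>, but \<open>v \<in> I\<close> shows that the two are not twins.
\<close>

lemma (in graph) nonadjacent_twins_imp_star:
  assumes conn: "Digraph_Component.connected G" and tw: "connected_rest_twins G"
    and V: "u \<in> verts G" "v \<in> verts G" and uv: "u \<noteq> v" "twins G u v" and nadj: "\<not> v \<rightarrow>\<^bsub>G\<^esub> u"
    and cover: "\<And>x. x \<in> verts G \<Longrightarrow> x = u \<or> x \<rightarrow>\<^bsub>G\<^esub> u \<or> twins G u x"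
  shows "K\<^bsub>1,card (verts G) - 1\<^esub> G"
proof -
  have irr: "\<not> x \<rightarrow>\<^bsub>G\<^esub> x" for x using adj_not_same by blast
  have sym: "x \<rightarrow>\<^bsub>G\<^esub> y \<longleftrightarrow> y \<rightarrow>\<^bsub>G\<^esub> x" for x y using dominates_sym by blast
  define N where "N = {x. x \<rightarrow>\<^bsub>G\<^esub> u}"
  define I where "I = verts G - N"
  have NV: "N \<subseteq> verts G" using adj_in_verts by (auto simp: N_def)
  have I_twins: "x = u \<or> twins G u x" if "x \<in> I" for x
    using that cover[of x] by (auto simp: I_def N_def)
  have uvI: "u \<in> I" "v \<in> I" using V nadj irr by (auto simp: I_def N_def)
  have NI: "x \<rightarrow>\<^bsub>G\<^esub> y" if "x \<in> N" "y \<in> I" for x y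
  proof -
    have "x \<noteq> u" "x \<noteq> y" using that irr by (auto simp: N_def I_def)
    then show ?thesis using I_twins[OF that(2)] that(1) unfolding twins_def N_def by blast
  qed
  have II: "\<not> x \<rightarrow>\<^bsub>G\<^esub> y" if "x \<in> I" "y \<in> I" for x y
  proof (cases "x = y \<or> x = u \<or> y = u")
    case True
    then show ?thesis using that irr sym by (auto simp: I_def N_def)
  next
    case False
    moreover have "\<not> x \<rightarrow>\<^bsub>G\<^esub> u" using that(1) by (simp add: I_def N_def)
    ultimately show ?thesis using I_twins[OF that(2)] unfolding twins_def by blast
  qed
  obtain q where q: "q \<in> N"
    using connected_induce_cut_arc[of "verts G" "{u}" u v] conn induce_verts V uv(1)
    by (auto simp: N_def)
  have qu: "q \<noteq> u" using q irr by (auto simp: N_def)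
  have N_eq: "x = q" if x: "x \<in> N" for x
  proof (rule ccontr)
    assume xq: "x \<noteq> q"
    have xu: "x \<noteq> u" and xv: "x \<noteq> v" using x nadj irr by (auto simp: N_def)
    have "Digraph_Component.connected (G \<restriction> (verts G - {u, x}))"
    proof (rule connected_induce_hub[of v])
      show "v \<in> verts G - {u, x}" using V(2) uv(1) xv by auto
      have q': "q \<in> verts G - {u, x}" using q NV xq qu by auto
      fix y assume "y \<in> verts G - {u, x}"
      then consider "y \<in> N" | "y \<in> I" by (auto simp: I_def)
      then show "y = v \<or> y \<rightarrow>\<^bsub>G\<^esub> v \<or> (\<exists>w\<in>verts G - {u, x}. y \<rightarrow>\<^bsub>G\<^esub> w \<and> w \<rightarrow>\<^bsub>G\<^esub> v)"
      proof cases
        case 1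
        then show ?thesis using NI uvI(2) by blast
      next
        case 2
        then have "y \<rightarrow>\<^bsub>G\<^esub> q" "q \<rightarrow>\<^bsub>G\<^esub> v" using NI q uvI(2) sym by blast+
        then show ?thesis using q' by blast
      qed
    qed
    then have "twins G u x"
      by (rule connected_rest_twinsD[OF tw]) (use V(1) x NV xu in auto)
    moreover have "v \<rightarrow>\<^bsub>G\<^esub> x" using NI[OF x uvI(2)] sym by blast
    ultimately show False using nadj uv(1) xv unfolding twins_def by metis
  qed
  have qV: "q \<in> verts G" using q NV by blast
  have I_eq: "x \<in> I \<longleftrightarrow> x \<in> verts G \<and> x \<noteq> q" for x
  proof -
    have "N = {q}" using N_eq q by blast
    then show ?thesis by (simp add: I_def)
  qed
  have "x \<rightarrow>\<^bsub>G\<^esub> y \<longleftrightarrow> x \<in> verts G \<and> y \<in> verts G \<and> (x = q) \<noteq> (y = q)" for x y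
  proof (cases "x \<in> verts G \<and> y \<in> verts G")
    case True
    then consider "x = q" "y = q" | "x = q" "y \<in> I" "y \<noteq> q" | "x \<in> I" "x \<noteq> q" "y = q"
      | "x \<in> I" "x \<noteq> q" "y \<in> I" "y \<noteq> q"
      using I_eq by metis
    then show ?thesis
    proof cases
      case 1
      then show ?thesis using irr by simp
    next
      case 2
      then show ?thesis using NI[OF q] True by simp
    next
      case 3
      then show ?thesis using NI[OF q] sym[of x y] True by simp
    next
      case 4
      then show ?thesis using II by simp
    qed
  next
    case False
    then show ?thesis using adj_in_verts by blast
  qed
  moreover have "card (verts G) \<ge> 2"
  proof -
    have "card {u, v} \<le> card (verts G)" using V by (intro card_mono) auto
    then show ?thesis using uv(1) by simp
  qed
  ultimately show ?thesis using star_digraph_iff qV by auto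
qed

lemma (in graph) complete_or_star_if_connected_rest_twins:
  assumes "Digraph_Component.connected G" "card (verts G) \<ge> 3" "connected_rest_twins G"
  shows "K\<^bsub>card (verts G)\<^esub> G \<or> K\<^bsub>1,card (verts G) - 1\<^esub> G"
proof -
  obtain u v where uv: "u \<in> verts G" "v \<in> verts G" "u \<noteq> v" "twins G u v"
    and cover: "\<And>x. x \<in> verts G \<Longrightarrow> x = u \<or> x \<rightarrow>\<^bsub>G\<^esub> u \<or> twins G u x"
    using neighbours_twins_cover[OF assms] by blast
  show ?thesis
  proof (cases "v \<rightarrow>\<^bsub>G\<^esub> u")
    case True
    then show ?thesis using adjacent_twins_imp_complete[OF assms(3) uv _ cover] by blast
  next
    case False
    then show ?thesis using nonadjacent_twins_imp_star[OF assms(1,3) uv _ cover] by blast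
  qed
qed

section \<open>The characterization\<close>

theorem corollary3p10:
  fixes G :: "('a, 'b) pre_digraph" and n :: nat
  assumes "graph G"
    and "Digraph_Component.connected G"
    and "card (verts G) = n"
    and "n \<ge> 2"
  shows "cdim G = n - 1 \<longleftrightarrow>
    (K\<^bsub>2\<^esub> G \<or> K\<^bsub>3\<^esub> G) \<or> (n \<ge> 4 \<and> (K\<^bsub>n\<^esub> G \<or> K\<^bsub>1,n - 1\<^esub> G))"
proof
  interpret graph G by fact
  assume "(K\<^bsub>2\<^esub> G \<or> K\<^bsub>3\<^esub> G) \<or> (n \<ge> 4 \<and> (K\<^bsub>n\<^esub> G \<or> K\<^bsub>1,n - 1\<^esub> G))"
  then consider "K\<^bsub>n\<^esub> G" | "n \<ge> 4" "K\<^bsub>1,n - 1\<^esub> G"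
    using assms(3) unfolding complete_digraph_def by auto
  then have "n - 1 \<le> card S" if "connected_resolving_set G S" for S
  proof cases
    case 1
    then show ?thesis
      using that complete_resolving_set_card_ge[of S] assms(3)
      by (simp add: connected_resolving_set_def)
  next
    case 2
    then show ?thesis using star_connected_resolving_set_card_ge that assms(3) by auto
  qed
  moreover obtain S where "connected_resolving_set G S" "card S = cdim G"
    using cdim_attained assms(1,2) by blast
  ultimately show "cdim G = n - 1"
    using cdim_le_card_minus_1 assms(2-4) by (metis le_antisym)
next
  interpret graph G by fact
  assume cdim: "cdim G = n - 1"
  have twins: "twins G u v"
    if uv: "u \<in> verts G" "v \<in> verts G" "u \<noteq> v"
      and conn: "Digraph_Component.connected (G \<restriction> (verts G - {u, v}))" for u v
  proof (rule ccontr)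
    assume "\<not> twins G u v"
    then have "cdim G \<le> card (verts G - {u, v})"
      using not_twins_resolving uv conn by (intro cdim_le) (simp add: connected_resolving_set_def)
    moreover have "card (verts G - {u, v}) = n - 2"
      using uv assms(3) by (simp add: card_Diff_subset)
    ultimately show False using cdim assms(4) by linarith
  qed
  show "(K\<^bsub>2\<^esub> G \<or> K\<^bsub>3\<^esub> G) \<or> (n \<ge> 4 \<and> (K\<^bsub>n\<^esub> G \<or> K\<^bsub>1,n - 1\<^esub> G))"
  proof (cases "n = 2")
    case True
    then obtain a b where ab: "verts G = {a, b}" "a \<noteq> b" using assms(3) by (auto simp: card_2_iff)
    obtain w x where "w \<in> verts G - {a}" "x \<in> {a}" "w \<rightarrow>\<^bsub>G\<^esub> x"
      using connected_induce_cut_arc[of "verts G" "{a}" a b] assms(2) induce_verts ab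
      by auto
    then have "a \<rightarrow>\<^bsub>G\<^esub> b" "b \<rightarrow>\<^bsub>G\<^esub> a" using ab dominates_sym by auto
    then have "K\<^bsub>card (verts G)\<^esub> G" using ab unfolding complete_digraph_iff by auto
    then show ?thesis using True assms(3) by simp
  next
    case False
    then have n3: "n \<ge> 3" using assms(4) by simp
    have "K\<^bsub>n\<^esub> G \<or> K\<^bsub>1,n - 1\<^esub> G"
      using complete_or_star_if_connected_rest_twins twins assms(2,3) n3
      by (auto simp: connected_rest_twins_def)
    \<comment> \<open>The centre and a leaf of the three-vertex star contradict \<open>twins\<close>.\<close>
    moreover have "n \<noteq> 3" if star: "K\<^bsub>1,n - 1\<^esub> G"
    proof
      assume "n = 3"
      obtain p where p: "p \<in> verts G"
        and adj: "\<And>x y. x \<rightarrow>\<^bsub>G\<^esub> y \<longleftrightarrow> x \<in> verts G \<and> y \<in> verts G \<and> (x = p) \<noteq> (y = p)"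
        using star star_digraph_iff assms(3,4) by auto
      have "card (verts G - {p}) = 2" using p \<open>n = 3\<close> assms(3) by simp
      then obtain x y where xy: "verts G - {p} = {x, y}" "x \<noteq> y" by (auto simp: card_2_iff)
      then have V: "x \<in> verts G" "y \<in> verts G" "x \<noteq> p" "y \<noteq> p" by auto
      have "verts G - {p, x} = {y}" using xy by auto
      then have "Digraph_Component.connected (G \<restriction> (verts G - {p, x}))"
        using connected_induce_hub[of y "{y}"] by auto
      then have "twins G p x" using twins p V by blast
      then have "y \<rightarrow>\<^bsub>G\<^esub> p \<longleftrightarrow> y \<rightarrow>\<^bsub>G\<^esub> x" using V xy unfolding twins_def by blast
      then show False using adj p V by simp
    qed
    ultimately show ?thesis using n3 by (cases "n = 3") auto
  qed
qed

end
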